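(* Let $k'\in(0,1)$, $k=\sqrt{1-k'^2}$, $L=\frac{k'-1}{k'+1}$, and let $\mathcal C$ be the coaxal pencil determined by the unit circle $T$ and the limit point $L$. If $C\in\mathcal C$ is an oriented circle (positively or negatively oriented, of positive radius) inside $T$, then there is a unique number $a\in(-K,K]$ such that the center of $C$ is the point $\left(\frac{\mathrm{dn}\,a-1}{\mathrm{dn}\,a+1},0\right)$, the radius of $C$ is $\frac{2\,\mathrm{cn}\,a}{1+\mathrm{dn}\,a}$, and $a$ is positive if $C$ is positively oriented and negative if $C$ is negatively oriented. Furthermore, writing $C_a$ for the circle with center $\left(\frac{\mathrm{dn}\,a-1}{\mathrm{dn}\,a+1},0\right)$ and radius $\frac{2\,\mathrm{cn}\,a}{1+\mathrm{dn}\,a}$, the circle $C_0$ is $T$, and $C_K$ is the point circle $L$ (center $L$, radius $0$).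
   Context: $T$ is the unit circle in the plane $\mathbb C=\mathbb R^2$; real numbers are identified with points of the $x$-axis. The power of a point $x$ with respect to a circle of center $M$ and radius $R\ge 0$ is $|x-M|^2-R^2$ (a point is a circle of radius $0$). The coaxal pencil $\mathcal C$ determined by $T$ and $L$ is the set of all circles $S$ (including point circles) such that every point of the line $x=\frac{L^2+1}{2L}$ (the radical axis of $T$ and the point circle $L$) has the same power with respect to $S$ as with respect to $T$, the centers lying on the $x$-axis. A circle is inside $T$ if it is contained in the open unit disc. Positively oriented means counterclockwise; negatively oriented means clockwise; no orientation is attached to $T$. Elliptic functions with modulus $k$: $g(\theta)=g(\theta;k)=\int_0^\theta \frac{dt}{\sqrt{1-k^2\sin^2 t}}$ for $\theta\in\mathbb R$, $K=g(\pi/2)$, $\mathrm{am}=g^{-1}:\mathbb R\to\mathbb R$, $\mathrm{sn}\,u=\sin(\mathrm{am}\,u)$, $\mathrm{cn}\,u=\cos(\mathrm{am}\,u)$, $\mathrm{dn}\,u=\sqrt{1-k^2\,\mathrm{sn}^2u}$. *)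

theory Defs
  imports "HOL-Analysis.Analysis"
begin

text \<open>Circles in the plane, identified with \<^typ>\<open>complex\<close>. The type does not enforce a nonnegative
  radius; that requirement is part of the pencil below. Radius 0 gives a point circle.\<close>

datatype circle = Circle (center: complex) (radius: real)

definition points :: "circle \<Rightarrow> complex set" where
  "points S = sphere (center S) (radius S)"

abbreviation unit_circle :: circle where
  "unit_circle \<equiv> Circle 0 1"

abbreviation point_circle :: "complex \<Rightarrow> circle" where
  "point_circle p \<equiv> Circle p 0"

text \<open>An oriented circle is a circle of positive radius together with one of the two senses of
  traversal: \<open>Positive\<close> is counterclockwise, \<open>Negative\<close> is clockwise.\<close>

datatype orientation = Positive | Negative

definition power_of_point :: "complex \<Rightarrow> circle \<Rightarrow> real" where
  "power_of_point x S = (cmod (x - center S))\<^sup>2 - (radius S)\<^sup>2"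

definition radical_line :: "real \<Rightarrow> complex set" where
  "radical_line L = {x. Re x = (L\<^sup>2 + 1) / (2 * L)}"

lemma radical_line_eq_radical_axis:
  assumes "L \<noteq> 0"
  shows "radical_line L =
    {x. power_of_point x unit_circle = power_of_point x (point_circle (complex_of_real L))}"
proof -
  have "x \<in> radical_line L \<longleftrightarrow>
    power_of_point x unit_circle = power_of_point x (point_circle (complex_of_real L))" for x
    unfolding radical_line_def power_of_point_def using assms
    by (simp add: cmod_power2) (auto simp: power2_eq_square field_simps)
  then show ?thesis by blast
qed

text \<open>The coaxal pencil determined by the unit circle and the point circle \<open>L\<close> on the real axis.\<close>

definition coaxal_pencil :: "real \<Rightarrow> circle set" where
  "coaxal_pencil L = {S. radius S \<ge> 0 \<and> Im (center S) = 0 \<and>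
     (\<forall>x\<in>radical_line L. power_of_point x S = power_of_point x unit_circle)}"

definition inside_unit_circle :: "circle \<Rightarrow> bool" where
  "inside_unit_circle S \<longleftrightarrow> points S \<subseteq> ball 0 1"

text \<open>Elliptic functions with modulus \<open>k\<close>. The interval integral is oriented, so
  \<open>ell_g k \<theta>\<close> is also correct for negative \<open>\<theta>\<close>.\<close>

definition ell_g :: "real \<Rightarrow> real \<Rightarrow> real" where
  "ell_g k \<theta> = (LBINT t=ereal 0..ereal \<theta>. 1 / sqrt (1 - k\<^sup>2 * (sin t)\<^sup>2))"

definition ell_K :: "real \<Rightarrow> real" where
  "ell_K k = ell_g k (pi / 2)"

definition ell_am :: "real \<Rightarrow> real \<Rightarrow> real" where
  "ell_am k = inv (ell_g k)"

definition ell_sn :: "real \<Rightarrow> real \<Rightarrow> real" where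
  "ell_sn k u = sin (ell_am k u)"

definition ell_cn :: "real \<Rightarrow> real \<Rightarrow> real" where
  "ell_cn k u = cos (ell_am k u)"

definition ell_dn :: "real \<Rightarrow> real \<Rightarrow> real" where
  "ell_dn k u = sqrt (1 - k\<^sup>2 * (ell_sn k u)\<^sup>2)"

definition ell_circle :: "real \<Rightarrow> real \<Rightarrow> circle" where
  "ell_circle k a = Circle (Complex ((ell_dn k a - 1) / (ell_dn k a + 1)) 0)
                           (2 * ell_cn k a / (1 + ell_dn k a))"

end

(* Write a circle of the pencil as center (m, 0) and radius r, and put d = (1 + m) / (1 - m).
   The pencil condition becomes r^2 = 4 (d^2 - k'^2) / (k^2 (1 + d)^2); being inside the unit disc
   with r > 0 means k' < d < 1. Hence (1 - d^2) / k^2 lies in (0, 1) and equals sin^2 of an amplitude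
   in (-pi/2, pi/2) which is unique once its sign is prescribed. *)
theory Submission imports Defs begin

text \<open>This bound makes the elliptic integrand continuous and positive on the whole line, and
  it keeps dn strictly positive at every amplitude.\<close>

lemma ell_integrand_pos:
  fixes k t :: real
  assumes "k\<^sup>2 < 1"
  shows "0 < 1 - k\<^sup>2 * (sin t)\<^sup>2"
proof -
  have "k\<^sup>2 * (sin t)\<^sup>2 \<le> k\<^sup>2 * 1"
    by (intro mult_left_mono) (auto simp: abs_square_le_1)
  then show ?thesis using assms by linarith
qed

lemma ell_g_has_real_derivative:
  assumes "k\<^sup>2 < 1"
  shows "(ell_g k has_real_derivative 1 / sqrt (1 - k\<^sup>2 * (sin \<theta>)\<^sup>2)) (at \<theta>)"
proof -
  define f :: "real \<Rightarrow> real" where "f = (\<lambda>t. 1 / sqrt (1 - k\<^sup>2 * (sin t)\<^sup>2))"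
  \<comment> \<open>The margin 1 puts both 0 and \<open>\<theta>\<close> in the interior of
    \<open>{-M..M}\<close>, so the derivative within that interval is a two-sided one, for either
    sign of \<open>\<theta>\<close>.\<close>
  define M where "M = \<bar>\<theta>\<bar> + 1"
  have "continuous_on {-M..M} f"
    unfolding f_def using ell_integrand_pos[OF assms]
    by (intro continuous_intros) (auto simp: less_le)
  then have "((\<lambda>u. LBINT y=ereal 0..ereal u. f y) has_vector_derivative f \<theta>) (at \<theta> within {-M..M})"
    using interval_integral_FTC2[of "-M" 0 M f \<theta>] by (simp add: M_def)
  moreover have "at \<theta> within {-M..M} = at \<theta>"
    by (rule at_within_Icc_at) (auto simp: M_def)
  moreover have "(\<lambda>u. LBINT y=ereal 0..ereal u. f y) = ell_g k"
    by (simp add: fun_eq_iff ell_g_def f_def)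
  ultimately show ?thesis
    by (simp add: has_real_derivative_iff_has_vector_derivative f_def)
qed

lemma strict_mono_ell_g:
  assumes "k\<^sup>2 < 1"
  shows "strict_mono (ell_g k)"
proof (rule strict_monoI)
  fix x y :: real
  assume "x < y"
  then show "ell_g k x < ell_g k y"
    using ell_g_has_real_derivative[OF assms] ell_integrand_pos[OF assms]
    by (intro DERIV_pos_imp_increasing[of x y "ell_g k"])
       (metis real_sqrt_gt_zero zero_less_divide_1_iff)+
qed

lemma ell_g_0 [simp]: "ell_g k 0 = 0"
  by (simp add: ell_g_def)

text \<open>The integrand is even, so reflection only moves the endpoints; swapping them back
  produces the sign.\<close>

lemma ell_g_minus: "ell_g k (- \<theta>) = - ell_g k \<theta>"
proof -
  have "ell_g k (- \<theta>) = (LBINT t=ereal \<theta>..ereal 0. 1 / sqrt (1 - k\<^sup>2 * (sin t)\<^sup>2))"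
    unfolding ell_g_def by (subst interval_integral_reflect) (simp add: zero_ereal_def)
  then show ?thesis
    unfolding ell_g_def by (subst interval_integral_endpoints_reverse) simp
qed

lemma ell_am_ell_g:
  assumes "k\<^sup>2 < 1"
  shows "ell_am k (ell_g k \<theta>) = \<theta>"
  unfolding ell_am_def
  by (rule inv_f_f) (rule strict_mono_imp_inj_on[OF strict_mono_ell_g[OF assms]])

text \<open>Intermediate value theorem: \<open>ell_g k\<close> is continuous and takes the values -K
  and K at -pi/2 and pi/2. Excluding -K excludes exactly the amplitude -pi/2. Uniqueness can then be
  argued in terms of angles.\<close>

lemma amplitude_exists:
  assumes k: "k\<^sup>2 < 1" and a: "a \<in> {- ell_K k <.. ell_K k}"
  obtains \<theta> where "- (pi / 2) < \<theta>" "\<theta> \<le> pi / 2" "a = ell_g k \<theta>"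
proof -
  have "\<exists>\<theta>\<ge>- (pi / 2). \<theta> \<le> pi / 2 \<and> ell_g k \<theta> = a"
    using a DERIV_isCont[OF ell_g_has_real_derivative[OF k]]
    by (intro IVT) (auto simp: ell_g_minus ell_K_def)
  then obtain \<theta> where \<theta>: "- (pi / 2) \<le> \<theta>" "\<theta> \<le> pi / 2" "ell_g k \<theta> = a" by blast
  moreover have "\<theta> \<noteq> - (pi / 2)"
    using \<theta>(3) a ell_g_minus[of k "pi / 2"] by (auto simp: ell_K_def)
  ultimately show ?thesis using that[of \<theta>] by force
qed

text \<open>Comparing powers at the real point x of the radical line gives r^2 = m^2 + 1 - 2 m x,
  and x = -(1 + k'^2) / (1 - k'^2). The denominator is cleared so that the relation stays
  polynomial.\<close>

lemma coaxal_pencil_radius: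
  assumes k': "0 < k'" "k' < 1" and L: "L = (k' - 1) / (k' + 1)"
    and C: "C \<in> coaxal_pencil L"
  shows "(1 - k'\<^sup>2) * (radius C)\<^sup>2
    = (1 - k'\<^sup>2) * ((Re (center C))\<^sup>2 + 1) + 2 * Re (center C) * (1 + k'\<^sup>2)"
proof -
  define m r x where "m = Re (center C)" and "r = radius C" and "x = (L\<^sup>2 + 1) / (2 * L)"
  have "Im (center C) = 0" using C by (simp add: coaxal_pencil_def)
  moreover have "power_of_point (Complex x 0) C = power_of_point (Complex x 0) unit_circle"
    using C by (simp add: coaxal_pencil_def radical_line_def x_def)
  ultimately have "(x - m)\<^sup>2 - r\<^sup>2 = x\<^sup>2 - 1"
    by (simp add: power_of_point_def cmod_power2 m_def r_def)
  then have r: "r\<^sup>2 = m\<^sup>2 + 1 - 2 * m * x" by (simp add: power2_eq_square algebra_simps)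
  have "k'\<^sup>2 < 1" using k' by (simp add: power_less_one_iff)
  have "L \<noteq> 0" using k' L by simp
  have L1: "L * (k' + 1) = k' - 1" using k' by (simp add: L)
  \<comment> \<open>Numerator and denominator of x are both scaled by
    \<open>(k' + 1)\<^sup>2\<close>, which turns them into polynomials in \<open>k'\<close>.\<close>
  then have "(L\<^sup>2 + 1) * (k' + 1)\<^sup>2 = 2 * (1 + k'\<^sup>2)" by algebra
  moreover have "L * (k' + 1)\<^sup>2 = - (1 - k'\<^sup>2)" using L1 by algebra
  moreover have "x * (2 * (L * (k' + 1)\<^sup>2)) = (L\<^sup>2 + 1) * (k' + 1)\<^sup>2"
    using \<open>L \<noteq> 0\<close> by (simp add: x_def)
  ultimately have "(1 - k'\<^sup>2) * x = - (1 + k'\<^sup>2)" by algebra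
  then have "(1 - k'\<^sup>2) * r\<^sup>2 = (1 - k'\<^sup>2) * (m\<^sup>2 + 1) + 2 * m * (1 + k'\<^sup>2)"
    unfolding r by algebra
  then show ?thesis by (simp add: m_def r_def)
qed

text \<open>The inclusion is tested at the two points m + r and m - r where the circle meets the
  real axis.\<close>

lemma inside_unit_circle_bounds:
  assumes "inside_unit_circle C" "Im (center C) = 0" "0 < radius C"
  shows "Re (center C) + radius C < 1" and "-1 < Re (center C) - radius C"
proof -
  define m r where "m = Re (center C)" and "r = radius C"
  have c: "center C = of_real m" using assms(2) by (simp add: complex_eq_iff m_def)
  have "complex_of_real (m + r) \<in> points C" "complex_of_real (m - r) \<in> points C"
    using assms(3) by (simp_all add: points_def c dist_norm r_def)
  then have "complex_of_real (m + r) \<in> ball 0 1" "complex_of_real (m - r) \<in> ball 0 1"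
    using assms(1) unfolding inside_unit_circle_def by blast+
  then have "\<bar>m + r\<bar> < 1" "\<bar>m - r\<bar> < 1"
    by (simp_all only: mem_ball_0 norm_of_real)
  then show "Re (center C) + radius C < 1" "-1 < Re (center C) - radius C"
    unfolding m_def r_def by linarith+
qed

text \<open>The number d is the future value of dn, obtained by inverting m = (d - 1) / (d + 1).
  Then d < 1 amounts to m < 0, and d > k' follows from r > 0.\<close>

lemma pencil_circle_parameter:
  fixes m r k' :: real
  assumes k': "0 < k'" "k' < 1" and r: "0 < r" and "m + r < 1" "-1 < m - r"
    and rad: "(1 - k'\<^sup>2) * r\<^sup>2 = (1 - k'\<^sup>2) * (m\<^sup>2 + 1) + 2 * m * (1 + k'\<^sup>2)"
  obtains d where "k' < d" "d < 1" "m = (d - 1) / (d + 1)"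
    "r\<^sup>2 = 4 * (d\<^sup>2 - k'\<^sup>2) / ((1 - k'\<^sup>2) * (1 + d)\<^sup>2)"
proof -
  define d where "d = (1 + m) / (1 - m)"
  have m: "-1 < m" "m < 1" using assms by linarith+
  have k1: "0 < 1 - k'\<^sup>2" using k' by (simp add: power_less_one_iff)
  \<comment> \<open>For m >= 0 the pencil relation would force r >= 1 + m, so the circle would reach
    -1 or beyond on the left.\<close>
  have "m < 0"
  proof (rule ccontr)
    assume "\<not> m < 0"
    then have m0: "0 \<le> m" by simp
    then have "2 * m * (1 - k'\<^sup>2) \<le> 2 * m * (1 + k'\<^sup>2)" by (intro mult_left_mono) auto
    then have "(1 - k'\<^sup>2) * (1 + m)\<^sup>2 \<le> (1 - k'\<^sup>2) * r\<^sup>2"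
      unfolding rad by (simp add: power2_eq_square algebra_simps)
    then have "(1 + m)\<^sup>2 \<le> r\<^sup>2" using k1 by (rule mult_left_le_imp_le)
    then have "1 + m \<le> r" by (rule power2_le_imp_le) (use r in simp)
    then show False using assms m0 by linarith
  qed
  have d: "0 < d" "d < 1" using m \<open>m < 0\<close> by (simp_all add: d_def field_simps)
  have m_eq: "m = (d - 1) / (d + 1)" using m by (simp add: d_def field_simps)
  have prod_eq: "(1 - k'\<^sup>2) * r\<^sup>2 * (1 + d)\<^sup>2 = 4 * (d\<^sup>2 - k'\<^sup>2)"
  proof -
    have "m * (1 + d) = d - 1" using d m_eq by (simp add: field_simps)
    then show ?thesis unfolding rad by algebra
  qed
  then have req: "r\<^sup>2 = 4 * (d\<^sup>2 - k'\<^sup>2) / ((1 - k'\<^sup>2) * (1 + d)\<^sup>2)"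
    using k1 d by (simp add: field_simps)
  have "0 < (1 - k'\<^sup>2) * r\<^sup>2 * (1 + d)\<^sup>2" using k1 r d by (intro mult_pos_pos) auto
  then have "k'\<^sup>2 < d\<^sup>2" unfolding prod_eq by simp
  then have "k' < d" by (rule power2_less_imp_less) (use d in simp)
  then show ?thesis using that d m_eq req by blast
qed

theorem theorem1:
  fixes k' k L :: real
  assumes "0 < k'" and "k' < 1"
    and "k = sqrt (1 - k'\<^sup>2)"
    and "L = (k' - 1) / (k' + 1)"
  shows "(\<forall>(C :: circle) (s :: orientation).
            C \<in> coaxal_pencil L \<and> radius C > 0 \<and> inside_unit_circle C \<longrightarrow>
            (\<exists>!a :: real. a \<in> {- ell_K k <.. ell_K k} \<and>
               center C = Complex ((ell_dn k a - 1) / (ell_dn k a + 1)) 0 \<and>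
               radius C = 2 * ell_cn k a / (1 + ell_dn k a) \<and>
               (s = Positive \<longrightarrow> a > 0) \<and> (s = Negative \<longrightarrow> a < 0)))
         \<and> ell_circle k 0 = unit_circle
         \<and> ell_circle k (ell_K k) = point_circle (complex_of_real L)"
proof (intro conjI allI impI)
  have k'2: "k'\<^sup>2 < 1" using assms(1,2) by (simp add: power_less_one_iff)
  then have k2: "k\<^sup>2 = 1 - k'\<^sup>2" using assms(3) by simp
  have k: "k\<^sup>2 < 1" using k2 assms(1) by simp
  have k0: "0 < k\<^sup>2" using k2 k'2 by simp
  note am = ell_am_ell_g[OF k]
  note mono = strict_mono_less[OF strict_mono_ell_g[OF k]]
  have am0: "ell_am k 0 = 0" using am[of 0] by simp
  have amK: "ell_am k (ell_K k) = pi / 2" by (simp add: ell_K_def am)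
  show "ell_circle k 0 = unit_circle"
    by (simp add: ell_circle_def ell_dn_def ell_sn_def ell_cn_def am0 complex_eq_iff)
  \<comment> \<open>At amplitude pi/2, cn vanishes and dn equals sqrt (1 - k^2) = k', which turns
    the center into L.\<close>
  show "ell_circle k (ell_K k) = point_circle (complex_of_real L)"
    using assms(1) by (simp add: ell_circle_def ell_dn_def ell_sn_def ell_cn_def amK k2
        assms(4) complex_eq_iff)
  fix C :: circle and s :: orientation
  assume C: "C \<in> coaxal_pencil L \<and> radius C > 0 \<and> inside_unit_circle C"
  define m r where "m = Re (center C)" and "r = radius C"
  have im: "Im (center C) = 0" using C by (simp add: coaxal_pencil_def)
  have r: "0 < r" using C r_def by simp
  obtain d where d: "k' < d" "d < 1" "m = (d - 1) / (d + 1)"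
      and rd: "r\<^sup>2 = 4 * (d\<^sup>2 - k'\<^sup>2) / ((1 - k'\<^sup>2) * (1 + d)\<^sup>2)"
    using pencil_circle_parameter[OF assms(1,2) r, of m]
      coaxal_pencil_radius[OF assms(1,2,4)] inside_unit_circle_bounds[of C] C im
    unfolding m_def r_def by blast
  have d0: "0 < d" using d assms by simp
  \<comment> \<open>This is the absolute value that sn must have for dn to equal d. It is positive
    because d < 1, and below 1 because d > k'.\<close>
  define \<sigma> where "\<sigma> = sqrt ((1 - d\<^sup>2) / k\<^sup>2)"
  have d2: "k'\<^sup>2 < d\<^sup>2" "d\<^sup>2 < 1"
    using d d0 assms by (simp_all add: power_strict_mono power_less_one_iff)
  have \<sigma>: "0 < \<sigma>" "\<sigma> < 1" "k\<^sup>2 * \<sigma>\<^sup>2 = 1 - d\<^sup>2"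
    using d2 k0 by (simp_all add: \<sigma>_def k2)
  \<comment> \<open>The orientation is encoded in the sign of the amplitude; sin^2 and cos, hence
    center and radius, are the same for both signs.\<close>
  define \<phi> where "\<phi> = (if s = Positive then arcsin \<sigma> else - arcsin \<sigma>)"
  have arc: "0 < arcsin \<sigma>" "arcsin \<sigma> < pi / 2"
    using \<sigma> arcsin_less_mono[of 0 \<sigma>] arcsin_less_mono[of \<sigma> 1] by auto
  have sin_\<phi>: "(sin \<phi>)\<^sup>2 = \<sigma>\<^sup>2" using \<sigma> by (simp add: \<phi>_def)
  have cos_\<phi>: "0 < cos \<phi>" using arc by (intro cos_gt_zero_pi) (auto simp: \<phi>_def)
  have dn_\<phi>: "ell_dn k (ell_g k \<phi>) = d"
    using d0 by (simp add: ell_dn_def ell_sn_def am sin_\<phi> \<sigma>)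
  \<comment> \<open>The radius formula is first proved for squares; positivity of r and of
    \<open>cos \<phi>\<close> then removes the squares.\<close>
  have "(r * (1 + d))\<^sup>2 * k\<^sup>2 = 4 * (d\<^sup>2 - k'\<^sup>2)"
    using d0 k'2 by (simp add: power_mult_distrib rd k2)
  also have "d\<^sup>2 - k'\<^sup>2 = k\<^sup>2 * (cos \<phi>)\<^sup>2"
    using \<sigma>(3) k2 by (simp add: cos_squared_eq sin_\<phi> right_diff_distrib)
  finally have "(r * (1 + d))\<^sup>2 = (2 * cos \<phi>)\<^sup>2" using k0 by (simp add: power_mult_distrib)
  then have "r * (1 + d) = 2 * cos \<phi>"
    by (rule power2_eq_imp_eq) (use r d0 cos_\<phi> in auto)
  then have r_eq: "r = 2 * cos \<phi> / (1 + d)" using d0 by (simp add: field_simps)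
  show "\<exists>!a. a \<in> {- ell_K k <.. ell_K k} \<and>
      center C = Complex ((ell_dn k a - 1) / (ell_dn k a + 1)) 0 \<and>
      radius C = 2 * ell_cn k a / (1 + ell_dn k a) \<and>
      (s = Positive \<longrightarrow> a > 0) \<and> (s = Negative \<longrightarrow> a < 0)"
  proof (intro ex1I[of _ "ell_g k \<phi>"] conjI impI)
    have "- (pi / 2) < \<phi>" "\<phi> < pi / 2" using arc by (auto simp: \<phi>_def)
    then have "ell_g k (- (pi / 2)) < ell_g k \<phi>" "ell_g k \<phi> < ell_g k (pi / 2)"
      using mono by blast+
    then show "ell_g k \<phi> \<in> {- ell_K k <.. ell_K k}"
      by (simp add: ell_g_minus ell_K_def)
    show "center C = Complex ((ell_dn k (ell_g k \<phi>) - 1) / (ell_dn k (ell_g k \<phi>) + 1)) 0"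
      using im d(3) by (simp add: dn_\<phi> complex_eq_iff m_def)
    show "radius C = 2 * ell_cn k (ell_g k \<phi>) / (1 + ell_dn k (ell_g k \<phi>))"
      using r_eq by (simp add: dn_\<phi> ell_cn_def am r_def)
    show "ell_g k \<phi> > 0" if "s = Positive"
      using arc that mono[of 0 \<phi>] by (simp add: \<phi>_def)
    show "ell_g k \<phi> < 0" if "s = Negative"
      using arc that mono[of \<phi> 0] by (simp add: \<phi>_def)
  next
    fix a
    assume a: "a \<in> {- ell_K k <.. ell_K k} \<and>
      center C = Complex ((ell_dn k a - 1) / (ell_dn k a + 1)) 0 \<and>
      radius C = 2 * ell_cn k a / (1 + ell_dn k a) \<and>
      (s = Positive \<longrightarrow> a > 0) \<and> (s = Negative \<longrightarrow> a < 0)"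
    then obtain \<theta> where \<theta>: "- (pi / 2) < \<theta>" "\<theta> \<le> pi / 2" "a = ell_g k \<theta>"
      using amplitude_exists[OF k] by blast
    define e where "e = ell_dn k a"
    have e: "e = sqrt (1 - k\<^sup>2 * (sin \<theta>)\<^sup>2)" by (simp add: e_def ell_dn_def ell_sn_def \<theta>(3) am)
    then have e0: "0 < e" using ell_integrand_pos[OF k] by simp
    \<comment> \<open>The map d -> (d - 1) / (d + 1) is injective for positive d, so the center
      determines dn.\<close>
    have "(d - 1) / (d + 1) = (e - 1) / (e + 1)" using a d(3) by (simp add: m_def e_def)
    then have "e = d" using e0 d0 by (simp add: field_simps)
    moreover have "e\<^sup>2 = 1 - k\<^sup>2 * (sin \<theta>)\<^sup>2" using e ell_integrand_pos[OF k, of \<theta>] by simp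
    ultimately have "k\<^sup>2 * (sin \<theta>)\<^sup>2 = 1 - d\<^sup>2" by simp
    then have "k\<^sup>2 * (sin \<theta>)\<^sup>2 = k\<^sup>2 * (sin \<phi>)\<^sup>2" by (simp only: sin_\<phi> \<sigma>(3))
    then have sq: "(sin \<theta>)\<^sup>2 = (sin \<phi>)\<^sup>2" using k0 by simp
    \<comment> \<open>The value of dn fixes sn up to sign. The orientation prescribes the sign of a,
      which is the sign of \<open>\<theta>\<close> by monotonicity and hence that of
      \<open>sin \<theta>\<close>.\<close>
    have sin_eq: "sin \<theta> = sin \<phi>"
    proof (cases s)
      case Positive
      then have "0 < \<theta>" using a \<theta>(3) mono[of 0 \<theta>] by simp
      then have "0 < sin \<theta>" using \<theta> by (intro sin_gt_zero) auto
      moreover have "0 < sin \<phi>" using Positive \<sigma> by (simp add: \<phi>_def)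
      ultimately show ?thesis using sq by (simp add: power2_eq_iff)
    next
      case Negative
      then have "\<theta> < 0" using a \<theta>(3) mono[of \<theta> 0] by simp
      then have "0 < sin (- \<theta>)" using \<theta> by (intro sin_gt_zero) auto
      moreover have "sin \<phi> < 0" using Negative \<sigma> by (simp add: \<phi>_def)
      ultimately show ?thesis using sq by (auto simp: power2_eq_iff)
    qed
    have \<phi>_bds: "- (pi / 2) \<le> \<phi>" "\<phi> \<le> pi / 2" using arc by (auto simp: \<phi>_def)
    have "\<theta> = \<phi>" by (rule sin_inj_pi) (use \<theta> \<phi>_bds sin_eq in auto)
    then show "a = ell_g k \<phi>" using \<theta>(3) by simp
  qed
qed

end
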